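(* Let $\Omega\subset\mathbb{R}^N$ be an open set, $q\in[1,\infty)$ and $r\in(0,1)$. Let $u\in W^{r,q}_{loc}(\Omega,\mathbb{R}^d)$ and let $K\subset\Omega$ be a compact set. Then for every $\varepsilon>0$ there exists a compact set $B\subset K$ such that $\mathcal{L}^N(K\setminus B)<\varepsilon$ and $u\in C^{0,r}(B,\mathbb{R}^d)$.
   Context: $N,d$ are natural numbers ($\geq 1$), and $\mathcal{L}^N$ is Lebesgue measure. For an open set $\Omega_0$, $u\in W^{r,q}(\Omega_0,\mathbb{R}^d)$ means $u\in L^q(\Omega_0,\mathbb{R}^d)$ and $\int_{\Omega_0}\int_{\Omega_0}\frac{|u(x)-u(y)|^q}{|x-y|^{N+rq}}\,dy\,dx<\infty$. $u\in W^{r,q}_{loc}(\Omega,\mathbb{R}^d)$ means $u\in W^{r,q}(\Omega_0,\mathbb{R}^d)$ for every open $\Omega_0\subset\subset\Omega$. $u\in C^{0,r}(B,\mathbb{R}^d)$ means that (for $u$ a given measurable function) the restriction of $u$ to $B$ is Hölder continuous with exponent $r$: there is a constant $C$ with $|u(x)-u(y)|\le C|x-y|^r$ for all $x,y\in B$. *)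

theory Defs
  imports "HOL-Analysis.Analysis"
begin

text \<open>
  Functions are total, but every definition below depends only on the values on the given set.
  Functions are representatives, not equivalence classes.  Measurability and integration on a
  set are with respect to the (complete) Lebesgue measure.
\<close>

definition Lq_space :: "real \<Rightarrow> (real ^ 'n) set \<Rightarrow> (real ^ 'n \<Rightarrow> real ^ 'd) set" where
  "Lq_space q S =
     {u. u \<in> borel_measurable (lebesgue_on S) \<and>
         (\<integral>\<^sup>+ x. ennreal (norm (u x) powr q) \<partial>lebesgue_on S) < \<infinity>}"

text \<open>
  The Gagliardo energy, with values in the extended nonnegative reals.  On the null set \<open>x = y\<close> the
  integrand is \<open>0 / 0 = 0\<close>.
\<close>

definition gagliardo_energy ::
    "real \<Rightarrow> real \<Rightarrow> (real ^ 'n) set \<Rightarrow> (real ^ 'n \<Rightarrow> real ^ 'd) \<Rightarrow> ennreal" where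
  "gagliardo_energy r q S u =
     (\<integral>\<^sup>+ x. (\<integral>\<^sup>+ y. ennreal (norm (u x - u y) powr q / norm (x - y) powr (real CARD('n) + r * q))
        \<partial>lebesgue_on S) \<partial>lebesgue_on S)"

definition frac_sobolev ::
    "real \<Rightarrow> real \<Rightarrow> (real ^ 'n) set \<Rightarrow> (real ^ 'n \<Rightarrow> real ^ 'd) set" where
  "frac_sobolev r q S = {u. u \<in> Lq_space q S \<and> gagliardo_energy r q S u < \<infinity>}"

definition frac_sobolev_loc ::
    "real \<Rightarrow> real \<Rightarrow> (real ^ 'n) set \<Rightarrow> (real ^ 'n \<Rightarrow> real ^ 'd) set" where
  "frac_sobolev_loc r q \<Omega> =
     {u. \<forall>S. open S \<and> compact (closure S) \<and> closure S \<subseteq> \<Omega> \<longrightarrow> u \<in> frac_sobolev r q S}"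

definition holder_on ::
    "real \<Rightarrow> 'a::real_normed_vector set \<Rightarrow> ('a \<Rightarrow> 'b::real_normed_vector) \<Rightarrow> bool" where
  "holder_on r B u \<longleftrightarrow> (\<exists>C::real. \<forall>x\<in>B. \<forall>y\<in>B. norm (u x - u y) \<le> C * norm (x - y) powr r)"

end

theory Submission
  imports Defs
begin

text \<open>
  Let \<open>F x\<close> be the inner integral of the Gagliardo energy over a neighbourhood of \<open>K\<close>.  By Markov's
  inequality, \<open>F x + norm (u x) powr q\<close> is bounded on a subset of \<open>K\<close> with small complement, and
  inner regularity makes this subset compact.  If \<open>x\<close> and \<open>y\<close> in it are at a small distance \<open>\<rho>\<close>,
  averaging \<open>norm (u x - u y) powr q \<le> 2 powr q * (norm (u x - u z) powr q + norm (u y - u z) powr q)\<close>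
  over the \<open>z\<close> in the ball of radius \<open>\<rho> / 2\<close> around the midpoint of \<open>x\<close> and \<open>y\<close> bounds the left
  side by a multiple of \<open>\<rho> powr (r * q) * (F x + F y)\<close>.  At larger distances boundedness of \<open>u\<close>
  suffices.
\<close>

section \<open>The Gagliardo integrand, its inner integral, and their measurability\<close>

definition gagliardo_kernel ::
    "real \<Rightarrow> real \<Rightarrow> (real ^ 'n \<Rightarrow> real ^ 'd) \<Rightarrow> real ^ 'n \<Rightarrow> real ^ 'n \<Rightarrow> real" where
  "gagliardo_kernel r q u x y =
     norm (u x - u y) powr q / norm (x - y) powr (real CARD('n) + r * q)"

text \<open>This is the function \<open>F\<close> of the outline. Its values are extended, since
  finite energy makes it finite only almost everywhere.\<close>

definition gagliardo_density ::
    "real \<Rightarrow> real \<Rightarrow> (real ^ 'n) set \<Rightarrow> (real ^ 'n \<Rightarrow> real ^ 'd) \<Rightarrow> real ^ 'n \<Rightarrow> ennreal" where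
  "gagliardo_density r q S u x = (\<integral>\<^sup>+ y. ennreal (gagliardo_kernel r q u x y) \<partial>lebesgue_on S)"

lemma gagliardo_energy_eq:
  "gagliardo_energy r q S u = (\<integral>\<^sup>+ x. gagliardo_density r q S u x \<partial>lebesgue_on S)"
  by (simp add: gagliardo_energy_def gagliardo_density_def gagliardo_kernel_def)

lemma gagliardo_kernel_nonneg [simp]: "0 \<le> gagliardo_kernel r q u x y"
  by (simp add: gagliardo_kernel_def)

lemma gagliardo_kernel_measurable_pair:
  fixes u :: "real ^ 'n \<Rightarrow> real ^ 'd"
  assumes [measurable]: "u \<in> borel_measurable (lebesgue_on S)"
  shows "case_prod (gagliardo_kernel r q u) \<in> borel_measurable (lebesgue_on S \<Otimes>\<^sub>M lebesgue_on S)"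
proof -
  have [measurable]: "(\<lambda>x :: real ^ 'n. x) \<in> borel_measurable (lebesgue_on S)"
    using id_borel_measurable_lebesgue_on[of S] by (simp add: id_def)
  show ?thesis
    unfolding gagliardo_kernel_def by measurable
qed

lemma gagliardo_kernel_measurable:
  fixes u :: "real ^ 'n \<Rightarrow> real ^ 'd"
  assumes [measurable]: "u \<in> borel_measurable (lebesgue_on S)"
  shows "gagliardo_kernel r q u x \<in> borel_measurable (lebesgue_on S)"
proof -
  have [measurable]: "(\<lambda>x :: real ^ 'n. x) \<in> borel_measurable (lebesgue_on S)"
    using id_borel_measurable_lebesgue_on[of S] by (simp add: id_def)
  show ?thesis
    unfolding gagliardo_kernel_def by measurable
qed

text \<open>Measurability of an inner integral is part of Tonelli's theorem, which asks for a
  sigma-finite measure; the finite measure of \<open>S\<close> supplies it. The neighbourhood of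
  \<open>K\<close> chosen later is bounded for this reason.\<close>

lemma gagliardo_density_measurable:
  assumes "S \<in> lmeasurable" and u: "u \<in> borel_measurable (lebesgue_on S)"
  shows "gagliardo_density r q S u \<in> borel_measurable (lebesgue_on S)"
proof -
  have "emeasure (lebesgue_on S) (space (lebesgue_on S)) \<noteq> \<infinity>"
    using assms(1) by (auto simp: emeasure_restrict_space fmeasurable_def)
  then interpret finite_measure "lebesgue_on S"
    by (rule finite_measureI)
  have "case_prod (\<lambda>x y. ennreal (gagliardo_kernel r q u x y))
      \<in> borel_measurable (lebesgue_on S \<Otimes>\<^sub>M lebesgue_on S)"
    using measurable_compose[OF gagliardo_kernel_measurable_pair[OF u] measurable_ennreal]
    by (simp add: case_prod_beta')
  then show ?thesis
    unfolding gagliardo_density_def by (rule borel_measurable_nn_integral)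
qed

section \<open>Pointwise estimates, and Hoelder continuity from a bounded density\<close>

lemma norm_diff_powr_triangle:
  fixes a b c :: "'a :: real_normed_vector"
  assumes "0 \<le> q"
  shows "norm (a - b) powr q \<le> 2 powr q * (norm (a - c) powr q + norm (b - c) powr q)"
proof -
  \<comment> \<open>Passing through the maximum replaces convexity of the power, so every
    \<open>q \<ge> 0\<close> is covered: the power of the maximum is one of the two
    summands.\<close>
  let ?m = "max (norm (a - c)) (norm (b - c))"
  have "norm (a - b) \<le> norm (a - c) + norm (b - c)"
    using norm_triangle_ineq4[of "a - c" "b - c"] by simp
  also have "\<dots> \<le> 2 * ?m"
    by simp
  finally have "norm (a - b) powr q \<le> (2 * ?m) powr q"
    using assms by (intro powr_mono2) auto
  also have "\<dots> = 2 powr q * ?m powr q"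
    by (simp add: powr_mult)
  also have "?m powr q \<le> norm (a - c) powr q + norm (b - c) powr q"
    by (simp add: max_def)
  finally show ?thesis
    by simp
qed

text \<open>The denominator of the kernel is nondecreasing in the distance because its exponent is
  nonnegative. On the diagonal, where the kernel is \<open>0 / 0 = 0\<close>, the left side vanishes
  too.\<close>

lemma norm_diff_powr_le_gagliardo_kernel:
  fixes u :: "real ^ 'n \<Rightarrow> real ^ 'd"
  assumes "0 \<le> r * q" and "norm (x - z) \<le> \<rho>"
  shows "norm (u x - u z) powr q \<le> \<rho> powr (real CARD('n) + r * q) * gagliardo_kernel r q u x z"
proof (cases "x = z")
  case False
  let ?p = "real CARD('n) + r * q"
  have "norm (u x - u z) powr q = norm (x - z) powr ?p * gagliardo_kernel r q u x z"
    using False by (simp add: gagliardo_kernel_def)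
  also have "\<dots> \<le> \<rho> powr ?p * gagliardo_kernel r q u x z"
    using assms by (intro mult_right_mono powr_mono2) auto
  finally show ?thesis .
qed (simp add: gagliardo_kernel_def)

text \<open>With \<open>\<rho> = norm (x - y)\<close>, comparison with the kernel costs the factor
  \<open>\<rho> powr (CARD('n) + r * q)\<close>, and averaging divides by a ball volume proportional
  to \<open>\<rho> ^ CARD('n)\<close>. The dimensional powers cancel and leave
  \<open>\<rho> powr (r * q)\<close>.\<close>

lemma gagliardo_density_local_estimate:
  fixes u :: "real ^ 'n \<Rightarrow> real ^ 'd"
  assumes S: "S \<in> sets lebesgue" and u: "u \<in> borel_measurable (lebesgue_on S)"
    and "0 < r" "0 < q" "0 \<le> M"
    and x: "gagliardo_density r q S u x \<le> ennreal M"
    and y: "gagliardo_density r q S u y \<le> ennreal M"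
    and "x \<noteq> y" and ball: "ball (midpoint x y) (norm (x - y) / 2) \<subseteq> S"
  shows "norm (u x - u y) powr q
    \<le> 2 powr q * (2 * M) * 2 ^ CARD('n) / unit_ball_vol (real CARD('n)) * norm (x - y) powr (r * q)"
proof -
  define \<rho> where "\<rho> = norm (x - y)"
  define G where "G = ball (midpoint x y) (\<rho> / 2)"
  define p where "p = real CARD('n) + r * q"
  define V where "V = unit_ball_vol (real CARD('n))"
  let ?k = "gagliardo_kernel r q u" and ?D = "gagliardo_density r q S u"
  have \<rho>: "0 < \<rho>" and V: "0 < V"
    using \<open>x \<noteq> y\<close> by (auto simp: \<rho>_def V_def)
  have G: "G \<subseteq> S" "G \<in> sets lebesgue"
    using ball by (auto simp: G_def \<rho>_def)
  have [measurable]: "?k w \<in> borel_measurable (lebesgue_on S)" for w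
    using u by (rule gagliardo_kernel_measurable)
  \<comment> \<open>A point of \<open>G\<close> is less than \<open>\<rho> / 2\<close> away from the
    midpoint, which is \<open>\<rho> / 2\<close> away from \<open>x\<close> and from
    \<open>y\<close>.\<close>
  have close: "norm (x - z) \<le> \<rho>" "norm (y - z) \<le> \<rho>" if "z \<in> G" for z
  proof -
    have "dist x (midpoint x y) = \<rho> / 2" "dist y (midpoint x y) = \<rho> / 2"
      unfolding \<rho>_def dist_norm[symmetric] by (rule dist_midpoint)+
    moreover have "dist (midpoint x y) z < \<rho> / 2"
      using that by (simp add: G_def)
    ultimately show "norm (x - z) \<le> \<rho>" "norm (y - z) \<le> \<rho>"
      using dist_triangle[of x z "midpoint x y"] dist_triangle[of y z "midpoint x y"]
      by (simp_all add: dist_norm)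
  qed
  have pt: "norm (u x - u y) powr q \<le> 2 powr q * \<rho> powr p * (?k x z + ?k y z)" if "z \<in> G" for z
  proof -
    have "norm (u x - u y) powr q \<le> 2 powr q * (norm (u x - u z) powr q + norm (u y - u z) powr q)"
      using \<open>0 < q\<close> by (intro norm_diff_powr_triangle) simp
    also have "\<dots> \<le> 2 powr q * (\<rho> powr p * ?k x z + \<rho> powr p * ?k y z)"
      unfolding p_def using close[OF that] \<open>0 < r\<close> \<open>0 < q\<close>
      by (intro mult_left_mono add_mono norm_diff_powr_le_gagliardo_kernel) auto
    finally show ?thesis
      by (simp add: algebra_simps)
  qed
  have "emeasure (lebesgue_on S) G = emeasure lborel G"
    using G S by (simp add: emeasure_restrict_space G_def)
  also have "\<dots> = ennreal (V * (\<rho> / 2) ^ CARD('n))"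
    using \<rho> by (simp add: G_def emeasure_ball V_def)
  finally have vol: "emeasure (lebesgue_on S) G = ennreal (V * (\<rho> / 2) ^ CARD('n))" .
  \<comment> \<open>The left side of \<open>pt\<close> does not depend on \<open>z\<close>, so
    integrating it over \<open>G\<close> produces the volume as a factor. On the right the kernels
    are nonnegative, so the integral may be enlarged to all of \<open>S\<close>, where it becomes
    the two densities.\<close>
  have "ennreal (norm (u x - u y) powr q * (V * (\<rho> / 2) ^ CARD('n)))
      = ennreal (norm (u x - u y) powr q) * emeasure (lebesgue_on S) G"
    unfolding vol using V \<rho> by (intro ennreal_mult) auto
  also have "\<dots> = (\<integral>\<^sup>+ z. ennreal (norm (u x - u y) powr q) * indicator G z \<partial>lebesgue_on S)"
    using G S by (intro nn_integral_cmult_indicator[symmetric]) (auto simp: sets_restrict_space_iff)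
  also have "\<dots> \<le> (\<integral>\<^sup>+ z. ennreal (2 powr q * \<rho> powr p) * (ennreal (?k x z) + ennreal (?k y z))
      \<partial>lebesgue_on S)"
    using pt
    by (intro nn_integral_mono)
      (auto simp flip: ennreal_mult ennreal_plus split: split_indicator intro!: ennreal_leI)
  also have "\<dots> = ennreal (2 powr q * \<rho> powr p) * (?D x + ?D y)"
    by (simp add: nn_integral_cmult nn_integral_add gagliardo_density_def)
  also have "\<dots> \<le> ennreal (2 powr q * \<rho> powr p) * (ennreal M + ennreal M)"
    using x y by (intro mult_left_mono add_mono) auto
  also have "\<dots> = ennreal (2 powr q * \<rho> powr p * (2 * M))"
    using \<open>0 \<le> M\<close> by (simp flip: ennreal_mult ennreal_plus)
  finally have "norm (u x - u y) powr q * (V * (\<rho> / 2) ^ CARD('n)) \<le> 2 powr q * \<rho> powr p * (2 * M)"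
    using \<open>0 \<le> M\<close> by (subst (asm) ennreal_le_iff) auto
  also have "\<rho> powr p = \<rho> ^ CARD('n) * \<rho> powr (r * q)"
    using \<rho> by (simp add: p_def powr_add powr_realpow)
  finally have "norm (u x - u y) powr q * V * \<rho> ^ CARD('n)
      \<le> 2 powr q * (2 * M) * 2 ^ CARD('n) * \<rho> powr (r * q) * \<rho> ^ CARD('n)"
    by (simp add: field_simps power_divide)
  then have "norm (u x - u y) powr q * V \<le> 2 powr q * (2 * M) * 2 ^ CARD('n) * \<rho> powr (r * q)"
    using \<rho> by (subst (asm) mult_le_cancel_right_pos) auto
  then show ?thesis
    using V by (simp add: field_simps V_def \<rho>_def)
qed

lemma holder_on_of_gagliardo_density_bounded:
  fixes u :: "real ^ 'n \<Rightarrow> real ^ 'd"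
  assumes S: "S \<in> sets lebesgue" and u: "u \<in> borel_measurable (lebesgue_on S)"
    and "0 < r" "0 < q" "0 \<le> M" "0 < \<delta>"
    and dens: "\<And>x. x \<in> B \<Longrightarrow> gagliardo_density r q S u x \<le> ennreal M"
    and bdd: "\<And>x. x \<in> B \<Longrightarrow> norm (u x) powr q \<le> M"
    and ball: "\<And>x. x \<in> B \<Longrightarrow> ball x \<delta> \<subseteq> S"
  shows "holder_on r B u"
proof -
  \<comment> \<open>\<open>C\<close> is the constant of the local estimate, before the
    \<open>q\<close>-th root is taken. \<open>A\<close> is chosen so that
    \<open>A * \<delta> powr r\<close> bounds the oscillation of \<open>u\<close> on
    \<open>B\<close>, which settles distances of at least \<open>\<delta>\<close>.\<close>
  define C where "C = 2 powr q * (2 * M) * 2 ^ CARD('n) / unit_ball_vol (real CARD('n))"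
  define A where "A = 2 * M powr (1 / q) / \<delta> powr r"
  have C: "0 \<le> C" and A: "0 \<le> A"
    using \<open>0 \<le> M\<close> by (auto simp: C_def A_def)
  have norm_le: "norm (u x) \<le> M powr (1 / q)" if "x \<in> B" for x
    using powr_mono2[of "1 / q" "norm (u x) powr q" M] bdd[OF that] \<open>0 < q\<close>
    by (simp add: powr_powr)
  have "norm (u x - u y) \<le> (C powr (1 / q) + A) * norm (x - y) powr r" if xy: "x \<in> B" "y \<in> B" for x y
  proof (cases "x = y")
    case False
    let ?\<rho> = "norm (x - y)"
    show ?thesis
    proof (cases "?\<rho> < \<delta>")
      case True
      \<comment> \<open>Points of the midpoint ball lie within \<open>?\<rho> < \<delta>\<close> of
        \<open>x\<close>, so it is enough that balls of radius \<open>\<delta>\<close> around points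
        of \<open>B\<close> lie in \<open>S\<close>.\<close>
      have "ball (midpoint x y) (?\<rho> / 2) \<subseteq> ball x \<delta>"
      proof
        fix z assume "z \<in> ball (midpoint x y) (?\<rho> / 2)"
        then show "z \<in> ball x \<delta>"
          using True dist_triangle[of x z "midpoint x y"] dist_midpoint(1)[of x y]
          by (simp add: dist_norm)
      qed
      then have "ball (midpoint x y) (?\<rho> / 2) \<subseteq> S"
        using ball[OF xy(1)] by (rule order_trans)
      then have "norm (u x - u y) powr q \<le> C * ?\<rho> powr (r * q)"
        unfolding C_def using assms xy False
        by (intro gagliardo_density_local_estimate[of S]) simp_all
      then have "(norm (u x - u y) powr q) powr (1 / q) \<le> (C * ?\<rho> powr (r * q)) powr (1 / q)"
        using \<open>0 < q\<close> by (intro powr_mono2) auto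
      then have "norm (u x - u y) \<le> C powr (1 / q) * ?\<rho> powr r"
        using \<open>0 < q\<close> C by (simp add: powr_powr powr_mult)
      also have "\<dots> \<le> (C powr (1 / q) + A) * ?\<rho> powr r"
        using A by (intro mult_right_mono) auto
      finally show ?thesis .
    next
      case False
      have "norm (u x - u y) \<le> 2 * M powr (1 / q)"
        using norm_triangle_ineq4[of "u x" "u y"] norm_le[OF xy(1)] norm_le[OF xy(2)] by linarith
      also have "\<dots> = A * \<delta> powr r"
        using \<open>0 < \<delta>\<close> by (simp add: A_def)
      also have "\<dots> \<le> A * ?\<rho> powr r"
        using False A \<open>0 < \<delta>\<close> \<open>0 < r\<close> by (intro mult_left_mono powr_mono2) auto
      also have "\<dots> \<le> (C powr (1 / q) + A) * ?\<rho> powr r"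
        by (intro mult_right_mono) auto
      finally show ?thesis .
    qed
  qed simp
  then show ?thesis
    unfolding holder_on_def by blast
qed

section \<open>Neighbourhoods of compact sets and Markov's inequality\<close>

lemma compact_bounded_open_neighbourhood:
  fixes K :: "'a :: heine_borel set"
  assumes "compact K" and "open \<Omega>" and "K \<subseteq> \<Omega>"
  obtains S \<delta> where "open S" "bounded S" "compact (closure S)" "closure S \<subseteq> \<Omega>" "0 < \<delta>"
    "\<And>x. x \<in> K \<Longrightarrow> ball x \<delta> \<subseteq> S"
proof -
  obtain e where e: "0 < e" "(\<Union>x\<in>K. ball x e) \<subseteq> \<Omega>"
    using compact_subset_open_imp_ball_epsilon_subset[OF assms] .
  \<comment> \<open>The halved radius leaves room for the closure: its points are within
    \<open>e / 2\<close> of \<open>S\<close>, hence within \<open>e\<close> of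
    \<open>K\<close>.\<close>
  define S where "S = (\<Union>x\<in>K. ball x (e / 2))"
  have "bounded S"
  proof -
    obtain a R where R: "K \<subseteq> ball a R"
      using bounded_subset_ballD[OF compact_imp_bounded[OF \<open>compact K\<close>]] by blast
    have "S \<subseteq> ball a (R + e)"
    proof
      fix z assume "z \<in> S"
      then obtain x where x: "x \<in> K" "dist x z < e / 2"
        by (auto simp: S_def)
      then have "dist a x < R"
        using R by auto
      then show "z \<in> ball a (R + e)"
        using x e dist_triangle[of a z x] by simp
    qed
    then show ?thesis
      using bounded_ball bounded_subset by blast
  qed
  moreover have "closure S \<subseteq> \<Omega>"
  proof
    fix z assume "z \<in> closure S"
    then obtain s where s: "s \<in> S" "dist s z < e / 2"
      using closure_approachable[of z S] e by (meson half_gt_zero)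
    then obtain x where x: "x \<in> K" "dist x s < e / 2"
      by (auto simp: S_def)
    have "dist x z < e"
      using dist_triangle[of x z s] s x by linarith
    then show "z \<in> \<Omega>"
      using e(2) x(1) by (auto simp: subset_iff)
  qed
  ultimately show thesis
    using e by (intro that[of S "e / 2"]) (auto simp: S_def)
qed

lemma small_superlevel_set:
  assumes f: "f \<in> borel_measurable M" and fin: "(\<integral>\<^sup>+ x. f x \<partial>M) < \<infinity>" and "0 < \<epsilon>"
  obtains c :: real where "0 \<le> c" "emeasure M {x \<in> space M. ennreal c < f x} < ennreal \<epsilon>"
proof -
  obtain I where I: "0 \<le> I" "(\<integral>\<^sup>+ x. f x \<partial>M) = ennreal I"
    using fin by (cases "\<integral>\<^sup>+ x. f x \<partial>M") auto
  \<comment> \<open>Adding 1 keeps \<open>c\<close> positive when \<open>I = 0\<close> and makes the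
    Markov bound \<open>I / c = \<epsilon> * I / (I + 1)\<close> strictly smaller than
    \<open>\<epsilon>\<close>.\<close>
  define c where "c = (I + 1) / \<epsilon>"
  have c: "0 < c"
    using I \<open>0 < \<epsilon>\<close> by (simp add: c_def)
  have "1 \<le> ennreal (1 / c) * f x" if "ennreal c < f x" for x
  proof -
    have "1 = ennreal (1 / c) * ennreal c"
      using c by (simp flip: ennreal_mult)
    also have "\<dots> \<le> ennreal (1 / c) * f x"
      using that by (intro mult_left_mono) auto
    finally show ?thesis .
  qed
  then have "emeasure M {x \<in> space M. ennreal c < f x}
      \<le> emeasure M {x \<in> space M. 1 \<le> ennreal (1 / c) * f x}"
    using f by (intro emeasure_mono) auto
  also have "\<dots> \<le> ennreal (1 / c) * (\<integral>\<^sup>+ x. f x * indicator (space M) x \<partial>M)"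
    using f by (intro nn_integral_Markov_inequality) auto
  also have "(\<integral>\<^sup>+ x. f x * indicator (space M) x \<partial>M) = ennreal I"
    unfolding I(2)[symmetric] by (intro nn_integral_cong) auto
  also have "ennreal (1 / c) * ennreal I = ennreal (I / c)"
    using c I by (simp flip: ennreal_mult)
  also have "\<dots> < ennreal \<epsilon>"
    using c I \<open>0 < \<epsilon>\<close> by (intro ennreal_lessI) (auto simp: c_def field_simps)
  finally show thesis
    using c by (intro that[of c]) auto
qed

theorem theorem1p9:
  fixes \<Omega> K :: "(real ^ 'n) set"
    and u :: "real ^ 'n \<Rightarrow> real ^ 'd"
    and q r \<epsilon> :: real
  assumes "open \<Omega>"
    and "1 \<le> q"
    and "0 < r" and "r < 1"
    and "u \<in> frac_sobolev_loc r q \<Omega>"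
    and "compact K" and "K \<subseteq> \<Omega>"
    and "0 < \<epsilon>"
  shows "\<exists>B. compact B \<and> B \<subseteq> K \<and> emeasure lebesgue (K - B) < ennreal \<epsilon> \<and> holder_on r B u"
proof -
  obtain S \<delta> where S: "open S" "bounded S" "compact (closure S)" "closure S \<subseteq> \<Omega>"
    and \<delta>: "0 < \<delta>" "\<And>x. x \<in> K \<Longrightarrow> ball x \<delta> \<subseteq> S"
    using compact_bounded_open_neighbourhood[OF assms(6,1,7)] by metis
  have Sm: "S \<in> lmeasurable" "S \<in> sets lebesgue"
    using S by (auto intro: lmeasurable_open)
  have "K \<subseteq> S"
    using \<delta> by force
  have "u \<in> frac_sobolev r q S"
    using assms(5) S by (simp add: frac_sobolev_loc_def)
  then have u [measurable]: "u \<in> borel_measurable (lebesgue_on S)"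
    and int: "(\<integral>\<^sup>+ x. ennreal (norm (u x) powr q) \<partial>lebesgue_on S) < \<infinity>"
    and energy: "gagliardo_energy r q S u < \<infinity>"
    by (auto simp: frac_sobolev_def Lq_space_def)
  note [measurable] = gagliardo_density_measurable[OF Sm(1) u]
  \<comment> \<open>Both summands are nonnegative, so one bound on the sum controls the density and
    \<open>u\<close> with a single exceptional set.\<close>
  define f where "f x = gagliardo_density r q S u x + ennreal (norm (u x) powr q)" for x
  have f: "f \<in> borel_measurable (lebesgue_on S)"
    unfolding f_def by measurable
  have "(\<integral>\<^sup>+ x. f x \<partial>lebesgue_on S) < \<infinity>"
    using int energy by (simp add: f_def nn_integral_add gagliardo_energy_eq)
  \<comment> \<open>Half of \<open>\<epsilon>\<close> is spent on the superlevel set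
    \<open>E\<close>, the other half on the closed approximation of \<open>K - E\<close> from
    inside.\<close>
  then obtain c :: real where c: "0 \<le> c"
    "emeasure (lebesgue_on S) {x \<in> space (lebesgue_on S). ennreal c < f x} < ennreal (\<epsilon> / 2)"
    using small_superlevel_set[OF f, of "\<epsilon> / 2"] \<open>0 < \<epsilon>\<close> by auto
  define E where "E = {x \<in> S. ennreal c < f x}"
  have "{x \<in> space (lebesgue_on S). ennreal c < f x} \<in> sets (lebesgue_on S)"
    using f by measurable
  then have Em: "E \<in> sets lebesgue"
    using Sm by (simp add: E_def sets_restrict_space_iff)
  have E: "emeasure lebesgue E < ennreal (\<epsilon> / 2)"
    using c Sm by (simp add: E_def emeasure_restrict_space)
  have Km: "K \<in> sets lebesgue"
    using \<open>compact K\<close> lmeasurable_compact by blast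
  obtain B where B: "closed B" "B \<subseteq> K - E" "(K - E) - B \<in> lmeasurable"
    "emeasure lebesgue ((K - E) - B) < ennreal (\<epsilon> / 2)"
    using sets_lebesgue_inner_closed[of "K - E" "\<epsilon> / 2"] Em Km \<open>0 < \<epsilon>\<close> by auto
  have "compact B"
    using B \<open>compact K\<close> by (metis Diff_subset compact_Int_closed inf.absorb_iff2 order_trans)
  moreover have "emeasure lebesgue (K - B) < ennreal \<epsilon>"
  proof -
    have "emeasure lebesgue (K - B) \<le> emeasure lebesgue (E \<union> ((K - E) - B))"
      using Em B by (intro emeasure_mono) auto
    also have "\<dots> \<le> emeasure lebesgue E + emeasure lebesgue ((K - E) - B)"
      using Em B by (intro emeasure_subadditive) auto
    also have "\<dots> < ennreal (\<epsilon> / 2 + \<epsilon> / 2)"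
      using E B(4) by (rule add_mono_ennreal)
    finally show ?thesis
      by simp
  qed
  moreover have "holder_on r B u"
  proof (rule holder_on_of_gagliardo_density_bounded[OF Sm(2) u])
    fix x assume "x \<in> B"
    then have "x \<in> K" and le: "f x \<le> ennreal c"
      using B \<open>K \<subseteq> S\<close> by (auto simp: E_def)
    then show "ball x \<delta> \<subseteq> S"
      using \<delta> by simp
    have "gagliardo_density r q S u x \<le> f x" "ennreal (norm (u x) powr q) \<le> f x"
      by (simp_all add: f_def)
    then have "gagliardo_density r q S u x \<le> ennreal c" "ennreal (norm (u x) powr q) \<le> ennreal c"
      using le by (blast intro: order_trans)+
    then show "gagliardo_density r q S u x \<le> ennreal c" "norm (u x) powr q \<le> c"
      using c(1) by simp_all
  qed (use assms \<delta> c in auto)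
  ultimately show ?thesis
    using B by blast
qed

end
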